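(* A signed graph $(G,\sigma)$ is flow-admissible if and only if $(G,\sigma)\in\mathcal{G}_2$, i.e. if and only if $(G,\sigma)$ is $\frac{1}{2q}$-flow-normalizable.
   Context: A signed graph $(G,\sigma)$ is a graph $G$ with a signature $\sigma:E(G)\to\{-1,+1\}$. Each edge $e=uv$ consists of half-edges $h_e^u$ and $h_e^v$; $H(v)$ is the set of half-edges at $v$. An orientation is a map $\tau$ from half-edges to $\{\pm1\}$ with $\tau(h_e^u)\tau(h_e^v)=-\sigma(e)$. For $f:E(G)\to\mathbb{R}$, $(\tau,f)$ is a flow if $\sum_{h\in H(v)}\tau(h)f(e_h)=0$ for every vertex $v$ ($e_h$ the edge containing $h$). For real $r\ge2$, a circular $r$-flow is a flow with $1\le|f(e)|\le r-1$ for all $e$; a nowhere-zero $k$-flow is a flow with integer values and $1\le |f(e)|\le k-1$; $(G,\sigma)$ is flow-admissible if it admits a nowhere-zero $k$-flow for some integer $k$. For a positive integer $\mu$, $(G,\sigma)$ is $\frac{1}{\mu q}$-flow-normalizable if, for all positive integers $p,q$, whenever it admits a circular $\frac pq$-flow (real flow values with absolute values in $[1,\frac pq-1]$), it admits a circular $\frac pq$-flow whose flow values have absolute values in $\{1,1+\frac1{\mu q},1+\frac{2}{\mu q},\dots,\frac pq-1-\frac1{\mu q},\frac pq-1\}$. $\mathcal{G}_\mu$ denotes the family of $\frac{1}{\mu q}$-flow-normalizable signed graphs.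
   Formalization: The family G_2 is taken to contain only signed graphs that admit some circular r-flow (r ≥ 2 real); otherwise graphs with no circular flow, such as a single positive edge joining two vertices, would be vacuously normalizable but not flow-admissible. *)

theory Defs
  imports Complex_Main
begin

text \<open>
  Signed graphs are finite, and loops and parallel edges are allowed.  Every edge \<open>e\<close> has exactly two
  half-edges, \<open>(e, False)\<close> and \<open>(e, True)\<close>; the labelling by booleans is an arbitrary naming and
  carries no direction.  The function \<open>half_end\<close> sends a half-edge to the vertex it is incident with,
  so a loop is an edge whose two half-edges have the same end, and then both of them
  contribute to the flow sum at that vertex.
\<close>

type_synonym 'e half_edge = "'e \<times> bool"

record ('v, 'e) signed_graph =
  vertex_set :: "'v set"
  edge_set :: "'e set"
  half_end :: "'e half_edge \<Rightarrow> 'v"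
  signature :: "'e \<Rightarrow> int"

definition half_edges :: "('v, 'e) signed_graph \<Rightarrow> 'e half_edge set" where
  "half_edges G = edge_set G \<times> UNIV"

definition half_edges_at :: "('v, 'e) signed_graph \<Rightarrow> 'v \<Rightarrow> 'e half_edge set" where
  "half_edges_at G v = {h \<in> half_edges G. half_end G h = v}"

locale finite_signed_graph =
  fixes G :: "('v, 'e) signed_graph"
  assumes finite_vertex_set: "finite (vertex_set G)"
    and finite_edge_set: "finite (edge_set G)"
    and half_end_in: "h \<in> half_edges G \<Longrightarrow> half_end G h \<in> vertex_set G"
    and signature_cases: "e \<in> edge_set G \<Longrightarrow> signature G e \<in> {-1, 1}"

definition is_orientation :: "('v, 'e) signed_graph \<Rightarrow> ('e half_edge \<Rightarrow> int) \<Rightarrow> bool" where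
  "is_orientation G \<tau> \<longleftrightarrow>
     (\<forall>h \<in> half_edges G. \<tau> h \<in> {-1, 1}) \<and>
     (\<forall>e \<in> edge_set G. \<tau> (e, False) * \<tau> (e, True) = - signature G e)"

definition is_flow ::
  "('v, 'e) signed_graph \<Rightarrow> ('e half_edge \<Rightarrow> int) \<Rightarrow> ('e \<Rightarrow> real) \<Rightarrow> bool" where
  "is_flow G \<tau> f \<longleftrightarrow>
     is_orientation G \<tau> \<and>
     (\<forall>v \<in> vertex_set G. (\<Sum>h \<in> half_edges_at G v. of_int (\<tau> h) * f (fst h)) = 0)"

definition is_circular_flow ::
  "('v, 'e) signed_graph \<Rightarrow> real \<Rightarrow> ('e half_edge \<Rightarrow> int) \<Rightarrow> ('e \<Rightarrow> real) \<Rightarrow> bool" where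
  "is_circular_flow G r \<tau> f \<longleftrightarrow>
     2 \<le> r \<and> is_flow G \<tau> f \<and> (\<forall>e \<in> edge_set G. 1 \<le> \<bar>f e\<bar> \<and> \<bar>f e\<bar> \<le> r - 1)"

definition admits_circular_flow :: "('v, 'e) signed_graph \<Rightarrow> real \<Rightarrow> bool" where
  "admits_circular_flow G r \<longleftrightarrow> (\<exists>\<tau> f. is_circular_flow G r \<tau> f)"

definition is_nowhere_zero_flow ::
  "('v, 'e) signed_graph \<Rightarrow> int \<Rightarrow> ('e half_edge \<Rightarrow> int) \<Rightarrow> ('e \<Rightarrow> real) \<Rightarrow> bool" where
  "is_nowhere_zero_flow G k \<tau> f \<longleftrightarrow>
     is_flow G \<tau> f \<and>
     (\<forall>e \<in> edge_set G. f e \<in> \<int> \<and> 1 \<le> \<bar>f e\<bar> \<and> \<bar>f e\<bar> \<le> of_int k - 1)"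

definition flow_admissible :: "('v, 'e) signed_graph \<Rightarrow> bool" where
  "flow_admissible G \<longleftrightarrow> (\<exists>k \<tau> f. is_nowhere_zero_flow G k \<tau> f)"

text \<open>
  The set \<open>{1, 1 + 1/(\<mu>q), 1 + 2/(\<mu>q), \<dots>, p/q - 1}\<close>.  Its last element \<open>p/q - 1\<close> is the one
  for \<open>i = \<mu>(p - 2q)\<close>.
\<close>

definition normalized_values :: "nat \<Rightarrow> nat \<Rightarrow> nat \<Rightarrow> real set" where
  "normalized_values \<mu> p q =
     {1 + real i / (real \<mu> * real q) | i :: nat.
        1 + real i / (real \<mu> * real q) \<le> real p / real q - 1}"

definition flow_normalizable :: "nat \<Rightarrow> ('v, 'e) signed_graph \<Rightarrow> bool" where
  "flow_normalizable \<mu> G \<longleftrightarrow>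
     (\<forall>p q :: nat. p > 0 \<longrightarrow> q > 0 \<longrightarrow>
        admits_circular_flow G (real p / real q) \<longrightarrow>
        (\<exists>\<tau> f. is_circular_flow G (real p / real q) \<tau> f \<and>
               (\<forall>e \<in> edge_set G. \<bar>f e\<bar> \<in> normalized_values \<mu> p q)))"

text \<open>
  A signed graph without any circular flow (for instance a single positive edge joining two
  vertices) satisfies \<open>flow_normalizable \<mu>\<close> vacuously although it is not flow-admissible.  The
  family is therefore taken among the signed graphs that have a circular \<open>r\<close>-flow for some
  real \<open>r\<close>, as is needed for it to coincide with the flow-admissible ones.
\<close>

definition normalizable_family :: "nat \<Rightarrow> ('v, 'e) signed_graph set" where
  "normalizable_family \<mu> =
     {G. finite_signed_graph G \<and> (\<exists>r. admits_circular_flow G r) \<and> flow_normalizable \<mu> G}"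

end

theory Submission
  imports Defs
begin

text \<open>
  The double cover of \<open>(G, \<tau>)\<close> is an ordinary digraph with two arcs per edge, to which every flow
  lifts by giving both arcs the value of the edge.  In a digraph, a real circulation can be rounded
  to an integral one between its floor and its ceiling: as long as it is not integral, the fractional
  arcs meet each of their ends at least twice, so some nonzero circulation is supported on them, and
  adding a multiple of it makes one more arc integral.  Rounding the lift of \<open>q \<cdot> f\<close> and averaging over the two arcs of every
  edge gives a half-integral flow that still respects the bounds \<open>q\<close> and \<open>p - q\<close>.
\<close>

section \<open>Linear algebra: underdetermined homogeneous systems\<close>

text \<open>Gaussian elimination, by induction on the equations: equation \<open>i\<close>
  eliminates an unknown \<open>k\<close> that has a nonzero coefficient in it, and is then solved
  for \<open>k\<close>. One equation and one unknown are lost, so the strict inequality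
  survives.\<close>

lemma homogeneous_system_nontrivial_solution:
  fixes A :: "'i \<Rightarrow> 'j \<Rightarrow> 'a::field"
  assumes "finite I" "finite J" "card I < card J"
  shows "\<exists>z. (\<exists>j\<in>J. z j \<noteq> 0) \<and> (\<forall>i\<in>I. (\<Sum>j\<in>J. A i j * z j) = 0)"
  using assms
proof (induction I arbitrary: J A rule: finite_induct)
  case empty
  then obtain j where "j \<in> J" by (metis card_gt_0_iff card.empty ex_in_conv)
  then show ?case by (intro exI[of _ "\<lambda>_. 1"]) auto
next
  case (insert i I)
  show ?case
  proof (cases "\<forall>j\<in>J. A i j = 0")
    case True
    have "card I < card J" using insert by simp
    from insert.IH[OF insert.prems(1) this, of A] True show ?thesis by fastforce
  next
    case False
    then obtain k where k: "k \<in> J" "A i k \<noteq> 0" by blast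
    define B where "B l j = A l j - A l k * A i j / A i k" for l j
    have "card I < card (J - {k})" using insert k by simp
    from insert.IH[OF _ this, of B] insert.prems(1) obtain z where
      z: "\<exists>j\<in>J - {k}. z j \<noteq> 0" "\<And>l. l \<in> I \<Longrightarrow> (\<Sum>j\<in>J - {k}. B l j * z j) = 0"
      by auto
    define S where "S = (\<Sum>j\<in>J - {k}. A i j * z j)"
    define y where "y = z(k := - S / A i k)"
    have split: "(\<Sum>j\<in>J. A l j * y j) = A l k * y k + (\<Sum>j\<in>J - {k}. A l j * z j)" for l
      unfolding sum.remove[OF insert.prems(1) k(1)]
      by (intro arg_cong2[where f = "(+)"] sum.cong) (auto simp: y_def)
    have "(\<Sum>j\<in>J. A i j * y j) = 0"
      unfolding split using k by (simp add: y_def S_def)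
    moreover have "(\<Sum>j\<in>J. A l j * y j) = 0" if "l \<in> I" for l
    proof -
      have "0 = (\<Sum>j\<in>J - {k}. A l j * z j - A l k / A i k * (A i j * z j))"
        unfolding z(2)[OF that, symmetric] B_def by (intro sum.cong) (auto simp: algebra_simps)
      also have "\<dots> = (\<Sum>j\<in>J - {k}. A l j * z j) - A l k / A i k * S"
        by (simp add: sum_subtractf sum_distrib_left S_def)
      finally show ?thesis unfolding split by (simp add: y_def)
    qed
    moreover have "\<exists>j\<in>J. y j \<noteq> 0" using z(1) by (auto simp: y_def)
    ultimately show ?thesis by auto
  qed
qed

section \<open>Rounding circulations in digraphs\<close>

text \<open>The vertex-arc incidence matrix; a loop contributes 0, as its two terms cancel.\<close>

definition net :: "('e \<Rightarrow> 'v) \<Rightarrow> ('e \<Rightarrow> 'v) \<Rightarrow> 'e \<Rightarrow> 'v \<Rightarrow> real" where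
  "net s t e v = of_bool (t e = v) - of_bool (s e = v)"

text \<open>Letting \<open>v\<close> range over its whole type avoids carrying a vertex set: where
  no arc of \<open>E\<close> ends, all terms vanish.\<close>

definition circulation :: "'e set \<Rightarrow> ('e \<Rightarrow> 'v) \<Rightarrow> ('e \<Rightarrow> 'v) \<Rightarrow> ('e \<Rightarrow> real) \<Rightarrow> bool" where
  "circulation E s t x \<longleftrightarrow> (\<forall>v. (\<Sum>e\<in>E. net s t e v * x e) = 0)"

lemma net_Ints [simp]: "net s t e v \<in> \<int>"
  by (simp add: net_def)

lemma net_eq_0: "s e \<noteq> v \<Longrightarrow> t e \<noteq> v \<Longrightarrow> net s t e v = 0"
  by (simp add: net_def)

lemma circulation_add:
  assumes "circulation E s t x" "circulation E s t z"
  shows "circulation E s t (\<lambda>e. x e + c * z e)"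
proof -
  have "(\<Sum>e\<in>E. net s t e v * (x e + c * z e)) =
      (\<Sum>e\<in>E. net s t e v * x e) + c * (\<Sum>e\<in>E. net s t e v * z e)" for v
    by (simp add: sum.distrib sum_distrib_left algebra_simps)
  with assms show ?thesis by (simp add: circulation_def)
qed

text \<open>If a single fractional arc met \<open>v\<close>, and with one end only, all other terms
  of the balance at \<open>v\<close> would be integers, forcing the value of that arc to be an
  integer too.\<close>

lemma fractional_degree_ge_2:
  assumes "finite E" "circulation E s t x" and F: "F = {e \<in> E. x e \<notin> \<int>}"
    and v: "v \<in> s ` F \<union> t ` F"
  shows "2 \<le> (\<Sum>e\<in>F. of_bool (s e = v) + of_bool (t e = v) :: nat)"
proof -
  have "finite F" using assms by simp
  obtain e where e: "e \<in> F" "s e = v \<or> t e = v" using v by auto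
  let ?d = "\<lambda>e. of_bool (s e = v) + of_bool (t e = v) :: nat"
  have split: "sum ?d F = ?d e + sum ?d (F - {e})"
    by (rule sum.remove) (use \<open>finite F\<close> e in auto)
  show ?thesis
  proof (cases "s e = t e \<or> (\<exists>e'\<in>F - {e}. s e' = v \<or> t e' = v)")
    case True
    then show ?thesis
    proof
      assume "\<exists>e'\<in>F - {e}. s e' = v \<or> t e' = v"
      then obtain e' where e': "e' \<in> F - {e}" "s e' = v \<or> t e' = v" by blast
      have "?d e' \<le> sum ?d (F - {e})"
        by (rule member_le_sum) (use \<open>finite F\<close> e' in auto)
      then show ?thesis using split e e' by auto
    qed (use split e in auto)
  next
    case False
    have "e \<in> E" using e F by simp
    have "net s t e' v * x e' \<in> \<int>" if "e' \<in> E - {e}" for e'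
    proof (cases "x e' \<in> \<int>")
      case True
      then show ?thesis by simp
    next
      case nonint: False
      then have "net s t e' v = 0" using False that F by (intro net_eq_0) auto
      then show ?thesis by simp
    qed
    then have "(\<Sum>e'\<in>E - {e}. net s t e' v * x e') \<in> \<int>" by (rule Ints_sum)
    moreover have "net s t e v * x e + (\<Sum>e'\<in>E - {e}. net s t e' v * x e') = 0"
      using assms(2) sum.remove[OF \<open>finite E\<close> \<open>e \<in> E\<close>, of "\<lambda>e. net s t e v * x e"]
      by (simp add: circulation_def)
    ultimately have "net s t e v * x e \<in> \<int>"
      by (metis Ints_minus eq_neg_iff_add_eq_0)
    \<comment> \<open>Since \<open>e\<close> is not a loop and has an end at \<open>v\<close>, its
      coefficient is 1 or -1.\<close>
    then have "x e \<in> \<int>"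
      using False e by (auto simp: net_def minus_in_Ints_iff split: if_splits)
    with e F show ?thesis by simp
  qed
qed

text \<open>A dimension count on the fractional arcs \<open>F\<close> and their ends
  \<open>W\<close>. Degrees of at least 2 give \<open>card W \<le> card F\<close>, and one balance
  equation is implied by the others, so fewer equations than unknowns have to be solved.\<close>

lemma fractional_circulation_direction:
  assumes "finite E" "circulation E s t x" "\<exists>e\<in>E. x e \<notin> \<int>"
  shows "\<exists>z. circulation E s t z \<and> (\<exists>e\<in>E. z e \<noteq> 0) \<and> (\<forall>e\<in>E. x e \<in> \<int> \<longrightarrow> z e = 0)"
proof -
  define F where "F = {e \<in> E. x e \<notin> \<int>}"
  define W where "W = s ` F \<union> t ` F"
  have fin: "finite F" "finite W" using assms(1) by (auto simp: F_def W_def)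
  obtain w where w: "w \<in> W" using assms(3) by (auto simp: F_def W_def)
  have "2 * card W = (\<Sum>v\<in>W. 2)" by simp
  also have "\<dots> \<le> (\<Sum>v\<in>W. \<Sum>e\<in>F. of_bool (s e = v) + of_bool (t e = v))"
    by (rule sum_mono, rule fractional_degree_ge_2[OF assms(1,2) F_def]) (simp add: W_def)
  also have "\<dots> = (\<Sum>e\<in>F. \<Sum>v\<in>W. of_bool (s e = v) + of_bool (t e = v))"
    by (rule sum.swap)
  \<comment> \<open>Every arc of \<open>F\<close> has both of its ends in \<open>W\<close>.\<close>
  also have "\<dots> = (\<Sum>e\<in>F. 2)"
    using fin by (intro sum.cong) (auto simp: sum.distrib of_bool_def W_def)
  finally have "card W \<le> card F" by simp
  moreover have "0 < card W" using w fin by (auto simp: card_gt_0_iff)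
  ultimately have "card (W - {w}) < card F" using fin w by simp
  then obtain y where y: "\<exists>e\<in>F. y e \<noteq> 0"
    "\<And>v. v \<in> W - {w} \<Longrightarrow> (\<Sum>e\<in>F. net s t e v * y e) = 0"
    using homogeneous_system_nontrivial_solution[of "W - {w}" F "\<lambda>v e. net s t e v"] fin by auto
  \<comment> \<open>Each column of the incidence matrix sums to 0 over \<open>W\<close>, so the
    balance at the omitted vertex \<open>w\<close> follows.\<close>
  have "(\<Sum>v\<in>W. \<Sum>e\<in>F. net s t e v * y e) = (\<Sum>e\<in>F. (\<Sum>v\<in>W. net s t e v) * y e)"
    by (subst sum.swap) (simp add: sum_distrib_right)
  also have "\<dots> = 0"
    using fin by (intro sum.neutral) (auto simp: net_def sum_subtractf of_bool_def W_def)
  finally have "(\<Sum>e\<in>F. net s t e w * y e) = 0"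
    using sum.remove[OF fin(2) w, of "\<lambda>v. \<Sum>e\<in>F. net s t e v * y e"] y(2) by simp
  with y(2) have W0: "(\<Sum>e\<in>F. net s t e v * y e) = 0" if "v \<in> W" for v
    using that by (cases "v = w") auto
  define z where "z e = (if e \<in> F then y e else 0)" for e
  have "(\<Sum>e\<in>E. net s t e v * z e) = 0" for v
  proof -
    have "(\<Sum>e\<in>E. net s t e v * z e) = (\<Sum>e\<in>F. net s t e v * y e)"
      by (rule sum.mono_neutral_cong_right) (use assms(1) in \<open>auto simp: F_def z_def\<close>)
    also have "\<dots> = 0"
    proof (cases "v \<in> W")
      case False
      then have "net s t e v = 0" if "e \<in> F" for e
        using that by (intro net_eq_0) (auto simp: W_def)
      then show ?thesis by simp
    qed (rule W0)
    finally show ?thesis .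
  qed
  then have "circulation E s t z" by (simp add: circulation_def)
  moreover have "\<exists>e\<in>E. z e \<noteq> 0" using y(1) by (auto simp: z_def F_def)
  moreover have "\<forall>e\<in>E. x e \<in> \<int> \<longrightarrow> z e = 0" by (simp add: z_def F_def)
  ultimately show ?thesis by blast
qed

text \<open>Move from \<open>x\<close> along a direction \<open>z\<close> supported on fractional
  arcs and stop when the first arc reaches an integer; until then every value stays between its
  floor and its ceiling.\<close>

lemma circulation_push:
  assumes "finite E" "circulation E s t x" "\<exists>e\<in>E. x e \<notin> \<int>"
  shows "\<exists>y. circulation E s t y \<and> {e \<in> E. y e \<notin> \<int>} \<subset> {e \<in> E. x e \<notin> \<int>} \<and>
    (\<forall>e\<in>E. of_int \<lfloor>x e\<rfloor> \<le> y e \<and> y e \<le> of_int \<lceil>x e\<rceil>)"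
proof -
  from fractional_circulation_direction[OF assms] obtain z where
    z: "circulation E s t z" "\<exists>e\<in>E. z e \<noteq> 0" "\<And>e. e \<in> E \<Longrightarrow> x e \<in> \<int> \<Longrightarrow> z e = 0"
    by blast
  define P where "P = {e \<in> E. z e \<noteq> 0}"
  \<comment> \<open>\<open>b e\<close> is the integer that the value of \<open>e\<close> is heading
    for, and \<open>r e\<close> the time at which it arrives.\<close>
  define b where "b e = (if z e > 0 then of_int \<lceil>x e\<rceil> else of_int \<lfloor>x e\<rfloor> :: real)" for e
  define r where "r e = (b e - x e) / z e" for e
  have "finite P" "P \<noteq> {}" using assms(1) z(2) by (auto simp: P_def)
  define c where "c = Min (r ` P)"
  have "c \<in> r ` P" unfolding c_def using \<open>finite P\<close> \<open>P \<noteq> {}\<close> by (intro Min_in) auto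
  then obtain e0 where e0: "e0 \<in> P" "c = r e0" by blast
  have r_nonneg: "0 \<le> r e" for e
  proof (cases "z e > 0")
    case True
    then show ?thesis by (simp add: r_def b_def)
  next
    \<comment> \<open>This includes \<open>z e = 0\<close>, where division by zero yields 0.\<close>
    case False
    then show ?thesis unfolding r_def b_def by (intro divide_nonpos_nonpos) (auto)
  qed
  have c_nonneg: "0 \<le> c" using e0(2) r_nonneg by simp
  have c_le: "c \<le> r e" if "e \<in> P" for e using that \<open>finite P\<close> by (simp add: c_def)
  define y where "y e = x e + c * z e" for e
  have bounds: "of_int \<lfloor>x e\<rfloor> \<le> y e \<and> y e \<le> of_int \<lceil>x e\<rceil>" if "e \<in> E" for e
  proof -
    consider "z e = 0" | "z e > 0" | "z e < 0" by linarith
    then show ?thesis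
    proof cases
      case 1
      then show ?thesis by (simp add: y_def)
    next
      case 2
      then have "c \<le> (of_int \<lceil>x e\<rceil> - x e) / z e"
        using c_le[of e] that by (simp add: P_def r_def b_def)
      then have "c * z e \<le> of_int \<lceil>x e\<rceil> - x e" using 2 by (simp add: pos_le_divide_eq)
      moreover have "0 \<le> c * z e" using 2 c_nonneg by simp
      moreover have "of_int \<lfloor>x e\<rfloor> \<le> x e" by simp
      ultimately show ?thesis unfolding y_def by linarith
    next
      case 3
      then have "c \<le> (of_int \<lfloor>x e\<rfloor> - x e) / z e"
        using c_le[of e] that by (simp add: P_def r_def b_def)
      then have "of_int \<lfloor>x e\<rfloor> - x e \<le> c * z e" using 3 by (simp add: neg_le_divide_eq)
      moreover have "c * z e \<le> 0" using 3 c_nonneg by (simp add: mult_nonneg_nonpos)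
      moreover have "x e \<le> of_int \<lceil>x e\<rceil>" by simp
      ultimately show ?thesis unfolding y_def by linarith
    qed
  qed
  have "y e0 = b e0" using e0 by (simp add: y_def r_def P_def)
  then have "y e0 \<in> \<int>" by (simp add: b_def)
  moreover have "e0 \<in> E" "x e0 \<notin> \<int>" using e0 z(3) by (auto simp: P_def)
  moreover have "y e \<in> \<int>" if "e \<in> E" "x e \<in> \<int>" for e
    using that z(3) by (simp add: y_def)
  ultimately have "{e \<in> E. y e \<notin> \<int>} \<subset> {e \<in> E. x e \<notin> \<int>}" by blast
  moreover have "circulation E s t y"
    unfolding y_def using circulation_add[OF assms(2) z(1)] .
  ultimately show ?thesis using bounds by blast
qed

text \<open>Induction on the number of fractional arcs. The bounds do not loosen along the way: the
  floor and ceiling of \<open>x e\<close> are integers enclosing \<open>x' e\<close>, hence they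
  enclose its floor and ceiling as well.\<close>

lemma circulation_rounding:
  assumes "finite E" "circulation E s t x"
  shows "\<exists>y. circulation E s t y \<and> (\<forall>e\<in>E. y e \<in> \<int>) \<and>
    (\<forall>e\<in>E. of_int \<lfloor>x e\<rfloor> \<le> y e \<and> y e \<le> of_int \<lceil>x e\<rceil>)"
  using assms(2)
proof (induction "card {e \<in> E. x e \<notin> \<int>}" arbitrary: x rule: less_induct)
  case less
  show ?case
  proof (cases "\<exists>e\<in>E. x e \<notin> \<int>")
    case False
    then show ?thesis using less.prems by (intro exI[of _ x]) auto
  next
    case True
    from circulation_push[OF assms(1) less.prems True] obtain x' where
      x': "circulation E s t x'" "{e \<in> E. x' e \<notin> \<int>} \<subset> {e \<in> E. x e \<notin> \<int>}"
      "\<And>e. e \<in> E \<Longrightarrow> of_int \<lfloor>x e\<rfloor> \<le> x' e \<and> x' e \<le> of_int \<lceil>x e\<rceil>"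
      by blast
    have "card {e \<in> E. x' e \<notin> \<int>} < card {e \<in> E. x e \<notin> \<int>}"
      using x'(2) assms(1) by (intro psubset_card_mono) auto
    from less.hyps[OF this x'(1)] obtain y where
      y: "circulation E s t y" "\<forall>e\<in>E. y e \<in> \<int>"
      "\<And>e. e \<in> E \<Longrightarrow> of_int \<lfloor>x' e\<rfloor> \<le> y e \<and> y e \<le> of_int \<lceil>x' e\<rceil>"
      by blast
    have "of_int \<lfloor>x e\<rfloor> \<le> y e \<and> y e \<le> of_int \<lceil>x e\<rceil>" if "e \<in> E" for e
    proof -
      have "\<lfloor>x e\<rfloor> \<le> \<lfloor>x' e\<rfloor>" "\<lceil>x' e\<rceil> \<le> \<lceil>x e\<rceil>"
        using x'(3)[OF that] by (simp_all add: le_floor_iff ceiling_le_iff)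
      then have "real_of_int \<lfloor>x e\<rfloor> \<le> of_int \<lfloor>x' e\<rfloor>" "real_of_int \<lceil>x' e\<rceil> \<le> of_int \<lceil>x e\<rceil>"
        by simp_all
      with y(3)[OF that] show ?thesis by linarith
    qed
    with y(1,2) show ?thesis by blast
  qed
qed

section \<open>The double cover: lifting and projecting flows\<close>

definition opp :: "'e half_edge \<Rightarrow> 'e half_edge" where
  "opp h = (fst h, \<not> snd h)"

text \<open>
  The half-edge \<open>h\<close> doubles as the arc of the double cover that traverses its edge starting at \<open>h\<close>.
  Above \<open>v\<close> lie the vertices \<open>(v, 1)\<close> and \<open>(v, -1)\<close>, at which a half-edge \<open>h\<close> counts with sign
  \<open>\<tau> h\<close> and \<open>- \<tau> h\<close>, respectively; the sides are chosen so that every arc is outgoing at \<open>h\<close> and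
  incoming at \<open>opp h\<close>.
\<close>

definition cover_tail ::
  "('v, 'e) signed_graph \<Rightarrow> ('e half_edge \<Rightarrow> int) \<Rightarrow> 'e half_edge \<Rightarrow> 'v \<times> int" where
  "cover_tail G \<tau> h = (half_end G h, - \<tau> h)"

definition cover_head ::
  "('v, 'e) signed_graph \<Rightarrow> ('e half_edge \<Rightarrow> int) \<Rightarrow> 'e half_edge \<Rightarrow> 'v \<times> int" where
  "cover_head G \<tau> h = (half_end G (opp h), \<tau> (opp h))"

lemma opp_opp [simp]: "opp (opp h) = h"
  by (simp add: opp_def)

lemma fst_opp [simp]: "fst (opp h) = fst h"
  by (simp add: opp_def)

lemma opp_in_half_edges [simp]: "opp h \<in> half_edges G \<longleftrightarrow> h \<in> half_edges G"
  by (cases h) (auto simp: opp_def half_edges_def)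

lemma sum_half_edges_opp: "(\<Sum>h\<in>half_edges G. g (opp h)) = (\<Sum>h\<in>half_edges G. g h)"
  by (rule sum.reindex_bij_witness[of _ opp opp]) auto

text \<open>Reindexing the incoming arcs by \<open>opp\<close> lets both halves of the balance at
  \<open>(v, c)\<close> run over the half-edges at \<open>v\<close>, as the flow sum does.\<close>

lemma cover_net_sum:
  "(\<Sum>h\<in>half_edges G. net (cover_tail G \<tau>) (cover_head G \<tau>) h (v, c) * x h) =
   (\<Sum>h\<in>half_edges G. of_bool (half_end G h = v) *
      (of_bool (\<tau> h = c) * x (opp h) - of_bool (\<tau> h = - c) * x h))"
proof -
  have "(\<Sum>h\<in>half_edges G. net (cover_tail G \<tau>) (cover_head G \<tau>) h (v, c) * x h) =
      (\<Sum>h\<in>half_edges G. of_bool (cover_head G \<tau> h = (v, c)) * x h) -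
      (\<Sum>h\<in>half_edges G. of_bool (cover_tail G \<tau> h = (v, c)) * x h)"
    by (simp add: net_def sum_subtractf left_diff_distrib)
  also have "(\<Sum>h\<in>half_edges G. of_bool (cover_head G \<tau> h = (v, c)) * x h) =
      (\<Sum>h\<in>half_edges G. of_bool (half_end G h = v) * (of_bool (\<tau> h = c) * x (opp h)))"
    by (subst sum_half_edges_opp[symmetric]) (auto simp: cover_head_def intro!: sum.cong)
  also have "(\<Sum>h\<in>half_edges G. of_bool (cover_tail G \<tau> h = (v, c)) * x h) =
      (\<Sum>h\<in>half_edges G. of_bool (half_end G h = v) * (of_bool (\<tau> h = - c) * x h))"
    by (auto simp: cover_tail_def intro!: sum.cong)
  finally show ?thesis by (simp add: sum_subtractf right_diff_distrib)
qed

context finite_signed_graph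
begin

lemma finite_half_edges: "finite (half_edges G)"
  unfolding half_edges_def using finite_edge_set by simp

lemma sum_half_edges_at:
  fixes g :: "'e half_edge \<Rightarrow> real"
  shows "(\<Sum>h\<in>half_edges_at G v. g h) = (\<Sum>h\<in>half_edges G. of_bool (half_end G h = v) * g h)"
  unfolding half_edges_at_def using finite_half_edges
  by (intro sum.mono_neutral_cong_left) auto

text \<open>With equal values on the two arcs of each edge, the balance at \<open>(v, c)\<close> is
  \<open>c\<close> times the flow sum at \<open>v\<close> if \<open>c\<close> is 1 or -1; for any
  other \<open>c\<close> no arc meets \<open>(v, c)\<close>.\<close>

lemma circulation_lift:
  assumes "is_flow G \<tau> f"
  shows "circulation (half_edges G) (cover_tail G \<tau>) (cover_head G \<tau>) (\<lambda>h. f (fst h))"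
  unfolding circulation_def
proof (intro allI, clarify)
  fix v c
  have sign: "\<tau> h \<in> {-1, 1}" if "h \<in> half_edges G" for h
    using assms that by (auto simp: is_flow_def is_orientation_def)
  have zero: "(\<Sum>h\<in>half_edges G. of_bool (half_end G h = v) * (of_int (\<tau> h) * f (fst h))) = 0"
  proof (cases "v \<in> vertex_set G")
    case True
    then show ?thesis using assms by (simp add: is_flow_def flip: sum_half_edges_at)
  next
    case False
    then show ?thesis using half_end_in by (intro sum.neutral) auto
  qed
  have "(\<Sum>h\<in>half_edges G. of_bool (half_end G h = v) *
        (of_bool (\<tau> h = c) * f (fst (opp h)) - of_bool (\<tau> h = - c) * f (fst h))) =
      (\<Sum>h\<in>half_edges G. (of_bool (c = 1) - of_bool (c = - 1)) *
        (of_bool (half_end G h = v) * (of_int (\<tau> h) * f (fst h))))"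
    by (rule sum.cong) (use sign in force)+
  also have "\<dots> = 0" by (simp only: flip: sum_distrib_left) (simp add: zero)
  finally show "(\<Sum>h\<in>half_edges G. net (cover_tail G \<tau>) (cover_head G \<tau>) h (v, c) * f (fst h)) = 0"
    by (simp only: cover_net_sum)
qed

text \<open>Up to the factor \<open>a\<close>, the flow sum at \<open>v\<close> is the balance at
  \<open>(v, 1)\<close> minus that at \<open>(v, -1)\<close>: in this difference both arcs of an
  edge count with sign \<open>\<tau> h\<close> at each of its half-edges \<open>h\<close>.\<close>

lemma flow_projection:
  assumes "is_orientation G \<tau>"
    and "circulation (half_edges G) (cover_tail G \<tau>) (cover_head G \<tau>) y"
  shows "is_flow G \<tau> (\<lambda>e. a * (y (e, False) + y (e, True)))"
proof -
  have sign: "\<tau> h \<in> {-1, 1}" if "h \<in> half_edges G" for h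
    using assms that by (auto simp: is_orientation_def)
  have pair: "y (fst h, False) + y (fst h, True) = y h + y (opp h)" for h
    by (cases h; cases "snd h") (auto simp: opp_def)
  have zero: "(\<Sum>h\<in>half_edges G. of_bool (half_end G h = v) *
      (of_bool (\<tau> h = c) * y (opp h) - of_bool (\<tau> h = - c) * y h)) = 0" for v c
    using assms(2) unfolding circulation_def by (simp only: flip: cover_net_sum)
  have "(\<Sum>h\<in>half_edges_at G v. of_int (\<tau> h) * (a * (y (fst h, False) + y (fst h, True)))) = 0" for v
  proof -
    have "(\<Sum>h\<in>half_edges_at G v. of_int (\<tau> h) * (a * (y (fst h, False) + y (fst h, True)))) =
      (\<Sum>h\<in>half_edges G. a * (
        of_bool (half_end G h = v) * (of_bool (\<tau> h = 1) * y (opp h) - of_bool (\<tau> h = - 1) * y h) -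
        of_bool (half_end G h = v) * (of_bool (\<tau> h = -1) * y (opp h) - of_bool (\<tau> h = - (-1)) * y h)))"
      unfolding sum_half_edges_at pair
      by (rule sum.cong[OF refl]) (use sign in \<open>force simp: algebra_simps\<close>)
    also have "\<dots> = 0"
      by (simp only: sum_subtractf zero flip: sum_distrib_left) simp
    finally show ?thesis .
  qed
  with assms(1) show ?thesis by (simp add: is_flow_def)
qed

section \<open>Half-integral flows and normalizability\<close>

lemma is_flow_scale:
  assumes "is_flow G \<tau> f"
  shows "is_flow G \<tau> (\<lambda>e. a * f e)"
proof -
  have "(\<Sum>h\<in>half_edges_at G v. of_int (\<tau> h) * (a * f (fst h))) =
      a * (\<Sum>h\<in>half_edges_at G v. of_int (\<tau> h) * f (fst h))" for v
    by (simp add: sum_distrib_left algebra_simps)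
  with assms show ?thesis by (simp add: is_flow_def)
qed

text \<open>Here \<open>k\<close> is the sum of the rounded values of the two arcs, not their mean,
  so it approximates \<open>2 * f\<close>. This doubling is the source of the denominator
  \<open>2 * q\<close>.\<close>

lemma half_integral_flow:
  assumes "is_flow G \<tau> f"
  shows "\<exists>k :: 'e \<Rightarrow> int. is_flow G \<tau> (\<lambda>e. of_int (k e)) \<and>
    (\<forall>e\<in>edge_set G. 2 * \<lfloor>f e\<rfloor> \<le> k e \<and> k e \<le> 2 * \<lceil>f e\<rceil>)"
proof -
  let ?H = "half_edges G"
  from circulation_rounding[OF finite_half_edges circulation_lift[OF assms]] obtain y where
    y: "circulation ?H (cover_tail G \<tau>) (cover_head G \<tau>) y" "\<And>h. h \<in> ?H \<Longrightarrow> y h \<in> \<int>"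
    "\<And>h. h \<in> ?H \<Longrightarrow> of_int \<lfloor>f (fst h)\<rfloor> \<le> y h \<and> y h \<le> of_int \<lceil>f (fst h)\<rceil>"
    by blast
  \<comment> \<open>On edges of \<open>G\<close> the sum is already an integer, and the floor only
    changes its type.\<close>
  define k where "k e = \<lfloor>y (e, False) + y (e, True)\<rfloor>" for e
  have k: "real_of_int (k e) = y (e, False) + y (e, True)" if "e \<in> edge_set G" for e
    unfolding k_def using y(2)[of "(e, False)"] y(2)[of "(e, True)"] that
    by (simp add: half_edges_def)
  have "is_flow G \<tau> (\<lambda>e. 1 * (y (e, False) + y (e, True)))"
    by (rule flow_projection[OF _ y(1)]) (use assms in \<open>simp add: is_flow_def\<close>)
  moreover have "(\<Sum>h\<in>half_edges_at G v. of_int (\<tau> h) * of_int (k (fst h))) =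
     (\<Sum>h\<in>half_edges_at G v. of_int (\<tau> h) * (1 * (y (fst h, False) + y (fst h, True))))" for v
    by (rule sum.cong) (auto simp: half_edges_at_def half_edges_def k)
  ultimately have "is_flow G \<tau> (\<lambda>e. of_int (k e))" by (simp add: is_flow_def)
  moreover have "2 * \<lfloor>f e\<rfloor> \<le> k e \<and> k e \<le> 2 * \<lceil>f e\<rceil>" if "e \<in> edge_set G" for e
    using y(3)[of "(e, False)"] y(3)[of "(e, True)"] k[OF that] that
    by (simp add: half_edges_def)
  ultimately show ?thesis by blast
qed

text \<open>Scaling by \<open>q\<close> turns the bounds \<open>1\<close> and
  \<open>p / q - 1\<close> into the integers \<open>q\<close> and \<open>p - q\<close>, which
  rounding cannot cross. Dividing \<open>k\<close> by \<open>2 * q\<close> then lands on the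
  required grid.\<close>

lemma flow_normalizable_2: "flow_normalizable 2 G"
  unfolding flow_normalizable_def
proof (intro allI impI)
  fix p q :: nat
  assume "p > 0" and q: "q > 0" and "admits_circular_flow G (real p / real q)"
  then obtain \<tau> f where f: "2 \<le> real p / real q" "is_flow G \<tau> f"
    "\<And>e. e \<in> edge_set G \<Longrightarrow> 1 \<le> \<bar>f e\<bar> \<and> \<bar>f e\<bar> \<le> real p / real q - 1"
    by (auto simp: admits_circular_flow_def is_circular_flow_def)
  obtain k where k: "is_flow G \<tau> (\<lambda>e. of_int (k e))"
    "\<And>e. e \<in> edge_set G \<Longrightarrow> 2 * \<lfloor>real q * f e\<rfloor> \<le> k e \<and> k e \<le> 2 * \<lceil>real q * f e\<rceil>"
    using half_integral_flow[OF is_flow_scale[OF f(2), of "real q"]] by blast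
  have bounds: "2 * int q \<le> \<bar>k e\<bar> \<and> \<bar>k e\<bar> \<le> 2 * (int p - int q)" if e: "e \<in> edge_set G" for e
  proof -
    have "real q * 1 \<le> real q * \<bar>f e\<bar>" "real q * \<bar>f e\<bar> \<le> real q * (real p / real q - 1)"
      using f(3)[OF e] by (intro mult_left_mono; simp)+
    then have b: "real q \<le> \<bar>real q * f e\<bar>" "\<bar>real q * f e\<bar> \<le> real p - real q"
      using q by (simp_all add: abs_mult right_diff_distrib)
    show ?thesis
    \<comment> \<open>The scaled value lies in one of the two intervals from \<open>q\<close> to
      \<open>p - q\<close> and from \<open>- (p - q)\<close> to \<open>- q\<close>. Their ends are
      integers, so its floor and ceiling lie in the same one.\<close>
    proof (cases "real q * f e \<ge> 0")
      case True
      then have "int q \<le> \<lfloor>real q * f e\<rfloor>" "\<lceil>real q * f e\<rceil> \<le> int p - int q"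
        using b by (auto simp: le_floor_iff ceiling_le_iff)
      then show ?thesis using k(2)[OF e] q by (simp add: abs_if)
    next
      case False
      then have "- (int p - int q) \<le> \<lfloor>real q * f e\<rfloor>" "\<lceil>real q * f e\<rceil> \<le> - int q"
        using b by (auto simp: le_floor_iff ceiling_le_iff)
      then show ?thesis using k(2)[OF e] q by (simp add: abs_if)
    qed
  qed
  define g where "g e = 1 / (2 * real q) * of_int (k e)" for e
  have abs_g: "\<bar>g e\<bar> = of_int \<bar>k e\<bar> / (2 * real q)" for e
    by (simp add: g_def abs_mult)
  have "is_flow G \<tau> g"
    unfolding g_def by (rule is_flow_scale[OF k(1)])
  moreover have g: "1 \<le> \<bar>g e\<bar> \<and> \<bar>g e\<bar> \<le> real p / real q - 1" if "e \<in> edge_set G" for e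
  proof -
    have "real_of_int (2 * int q) \<le> of_int \<bar>k e\<bar>" "real_of_int \<bar>k e\<bar> \<le> of_int (2 * (int p - int q))"
      using bounds[OF that] by (simp_all only: of_int_le_iff)
    then show ?thesis unfolding abs_g using q by (simp add: field_simps)
  qed
  moreover have "\<bar>g e\<bar> \<in> normalized_values 2 p q" if "e \<in> edge_set G" for e
  proof -
    \<comment> \<open>The number of grid steps above 1; \<open>bounds\<close> ensures that
      \<open>nat\<close> truncates nothing.\<close>
    define i where "i = nat (\<bar>k e\<bar> - 2 * int q)"
    have "real i = of_int \<bar>k e\<bar> - 2 * real q" using bounds[OF that] by (simp add: i_def)
    then have "\<bar>g e\<bar> = 1 + real i / (real 2 * real q)" unfolding abs_g using q
      by (simp add: field_simps)
    then show ?thesis using g[OF that] unfolding normalized_values_def by auto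
  qed
  ultimately show "\<exists>\<tau> f. is_circular_flow G (real p / real q) \<tau> f \<and>
      (\<forall>e \<in> edge_set G. \<bar>f e\<bar> \<in> normalized_values 2 p q)"
    using f(1) unfolding is_circular_flow_def by blast
qed

end

section \<open>Flow-admissibility versus circular flows\<close>

lemma admits_circular_flow_mono:
  "admits_circular_flow G r \<Longrightarrow> r \<le> r' \<Longrightarrow> admits_circular_flow G r'"
  unfolding admits_circular_flow_def is_circular_flow_def by fastforce

lemma flow_admissible_imp_circular:
  assumes "flow_admissible G"
  shows "\<exists>r. admits_circular_flow G r"
proof -
  obtain k \<tau> f where f: "is_nowhere_zero_flow G k \<tau> f"
    using assms by (auto simp: flow_admissible_def)
  \<comment> \<open>In a graph without edges \<open>k\<close> may be below 2, but a circular flow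
    requires \<open>2 \<le> r\<close>.\<close>
  then have "is_circular_flow G (max 2 (of_int k)) \<tau> f"
    by (fastforce simp: is_nowhere_zero_flow_def is_circular_flow_def)
  then show ?thesis by (auto simp: admits_circular_flow_def)
qed

text \<open>Raise \<open>r\<close> to an integer \<open>p\<close> and normalize with
  \<open>q = 1\<close>: all values become multiples of \<open>1 / \<mu>\<close>, and multiplying by
  \<open>\<mu>\<close> makes them integers.\<close>

lemma normalizable_imp_flow_admissible:
  assumes "finite_signed_graph G" "admits_circular_flow G r" "flow_normalizable \<mu> G" "\<mu> > 0"
  shows "flow_admissible G"
proof -
  interpret finite_signed_graph G by fact
  define p where "p = nat \<lceil>r\<rceil>"
  have "2 \<le> r" using assms(2) by (auto simp: admits_circular_flow_def is_circular_flow_def)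
  then have p: "r \<le> real p / real 1" "p > 0" by (auto simp: p_def)
  then obtain \<tau> f where f: "is_circular_flow G (real p / real 1) \<tau> f"
    "\<And>e. e \<in> edge_set G \<Longrightarrow> \<bar>f e\<bar> \<in> normalized_values \<mu> p 1"
    using admits_circular_flow_mono[OF assms(2) p(1)] assms(3)
    unfolding flow_normalizable_def by (metis less_numeral_extra(1))
  \<comment> \<open>The bound \<open>\<mu> * p\<close> suffices, because
    \<open>\<mu> * (p - 1) \<le> \<mu> * p - 1\<close> for positive \<open>\<mu>\<close>.\<close>
  have "is_nowhere_zero_flow G (int (\<mu> * p)) \<tau> (\<lambda>e. real \<mu> * f e)"
    unfolding is_nowhere_zero_flow_def
  proof (intro conjI ballI)
    show "is_flow G \<tau> (\<lambda>e. real \<mu> * f e)"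
      using f(1) by (intro is_flow_scale) (simp add: is_circular_flow_def)
  next
    fix e assume e: "e \<in> edge_set G"
    have b: "1 \<le> \<bar>f e\<bar>" "\<bar>f e\<bar> \<le> real p - 1" using f(1) e by (auto simp: is_circular_flow_def)
    obtain i :: nat where "\<bar>f e\<bar> = 1 + real i / real \<mu>"
      using f(2)[OF e] by (auto simp: normalized_values_def)
    then have "real \<mu> * \<bar>f e\<bar> = real (\<mu> + i)" using \<open>\<mu> > 0\<close> by (simp add: field_simps)
    then have "\<bar>real \<mu> * f e\<bar> \<in> \<int>" by (simp add: abs_mult)
    then show "real \<mu> * f e \<in> \<int>" by (simp add: abs_if minus_in_Ints_iff split: if_splits)
    have "1 * 1 \<le> real \<mu> * \<bar>f e\<bar>" using b \<open>\<mu> > 0\<close> by (intro mult_mono) auto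
    then show "1 \<le> \<bar>real \<mu> * f e\<bar>" by (simp add: abs_mult)
    have "real \<mu> * \<bar>f e\<bar> \<le> real \<mu> * (real p - 1)" using b by (intro mult_left_mono) auto
    then show "\<bar>real \<mu> * f e\<bar> \<le> of_int (int (\<mu> * p)) - 1"
      using \<open>\<mu> > 0\<close> by (simp add: abs_mult right_diff_distrib)
  qed
  then show ?thesis by (auto simp: flow_admissible_def)
qed

theorem theorem5p4:
  fixes G :: "('v, 'e) signed_graph"
  assumes "finite_signed_graph G"
  shows "flow_admissible G \<longleftrightarrow> G \<in> normalizable_family 2"
  using assms flow_admissible_imp_circular finite_signed_graph.flow_normalizable_2
    normalizable_imp_flow_admissible[of G _ 2]
  unfolding normalizable_family_def by auto

end
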